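(* Suppose a left cancellative monoid $S$ is C$^*$-regular and $\mathcal G_P(S)=\mathcal G(S)$. Then $S$ is strongly C$^*$-regular.
   Context: $S$ is a left cancellative monoid ($st=st'\Rightarrow t=t'$). Identify $s\in S$ with the injection $S\to S$, $t\mapsto st$, and let $s^{-1}$ be the inverse partial bijection $sS\to S$. $I_\ell(S)$ is the inverse semigroup of partial bijections of $S$ generated by the left translations; its elements are the compositions $s_{2n}^{-1}s_{2n-1}\cdots s_2^{-1}s_1$. $\mathcal J(S)=\{\operatorname{dom} g: g\in I_\ell(S)\}$ is the set of constructible right ideals, a semigroup under intersection. $\bar{\mathcal J}(S)$ is obtained from $\mathcal J(S)$ by adding all sets $X\setminus\bigcup_{i=1}^mX_i$ with $X,X_i\in\mathcal J(S)$. $p_X$ is the identity map on $X\subseteq S$. "$hs=s$" means $s\in\operatorname{dom}h$ and $h(s)=s$; "$hp_Y=p_Y$" means $Y\subseteq\operatorname{dom}h$ and $h$ fixes every point of $Y$. $S$ is strongly C$^*$-regular if, whenever $h_1,\dots,h_n\in I_\ell(S)$ and $X,X_1,\dots,X_m\in\mathcal J(S)$ ($m\ge0$) satisfy $\emptyset\ne X\setminus\bigcup_iX_i\subseteq\bigcup_{k=1}^n\{s: h_ks=s\}$, there are $Y_1,\dots,Y_l\in\mathcal J(S)$ and indices $1\le k_j\le n$ with $X\setminus\bigcup_iX_i\subseteq\bigcup_jY_j$ and $h_{k_j}p_{Y_j}=p_{Y_j}$ for all $j$. $S$ is C$^*$-regular if, whenever $h_1,\dots,h_n\in I_\ell(S)$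 and $X\in\bar{\mathcal J}(S)$ satisfy $\emptyset\neq X\subseteq\bigcup_{k=1}^n\{s: h_ks=s\}$, there are $Y_1,\dots,Y_l\in\bar{\mathcal J}(S)$ and indices $1\le k_j\le n$ with $X\subseteq\bigcup_jY_j$ and $h_{k_j}p_{Y_j}=p_{Y_j}$ for all $j$. Characters are nonzero semigroup homomorphisms $\chi:\mathcal J(S)\to\{0,1\}$, with the topology of pointwise convergence. $\chi_s(X)=1$ iff $s\in X$. $\Omega(S)=\overline{\{\chi_s:s\in S\}}$. Each $\chi\in\Omega(S)$ extends to $\bar{\mathcal J}(S)$ by $\chi(X\setminus\bigcup_iX_i)=1$ iff $\chi(X)=1$ and $\chi(X_i)=0$ for all $i$. $\mathcal G_P(S)$ is the set of classes $[g,\chi]$ of pairs $(g,\chi)\in I_\ell(S)\times\Omega(S)$ with $\chi(\operatorname{dom}g)=1$, where $(g_1,\chi_1)\sim(g_2,\chi_2)$ iff $\chi_1=\chi_2$ and $g_1|_A=g_2|_A$ for some $A\in\mathcal J(S)$ with $\chi_1(A)=1$; it is a groupoid with product $[g,\chi][h,\psi]=[gh,\psi]$ if $\chi=\psi(h^{-1}(\cdot))$. $\mathcal G(S)=\mathcal G_P(S)/\sim_2$, where $[g,\chi]\sim_2[h,\chi]$ iff $g|_X=h|_X$ for some $X\in\bar{\mathcal J}(S)$ with $\chi(X)=1$. "$\mathcal G_P(S)=\mathcal G(S)$" means that the quotient map $\mathcal G_P(S)\to\mathcal G(S)$ is injective. *)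

theory Defs
  imports "HOL-Algebra.Group" "HOL-Analysis.Function_Topology"
begin

locale left_cancellative_monoid = monoid S for S (structure) +
  assumes left_cancel:
    "\<lbrakk>s \<in> carrier S; t \<in> carrier S; t' \<in> carrier S; s \<otimes> t = s \<otimes> t'\<rbrakk> \<Longrightarrow> t = t'"


section \<open>The left inverse hull and the constructible right ideals\<close>

text \<open>
  Partial bijections of \<open>S\<close> are represented by maps \<open>'a \<rightharpoonup> 'a\<close>; composition, domain and
  restriction are the library's \<open>\<circ>\<^sub>m\<close>, \<open>dom\<close> and \<open>|`\<close>. The restriction \<open>g |` A\<close> does not require
  \<open>A \<subseteq> dom g\<close>; its domain is \<open>dom g \<inter> A\<close>.
\<close>

definition left_translation :: "('a, 'b) monoid_scheme \<Rightarrow> 'a \<Rightarrow> 'a \<rightharpoonup> 'a" where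
  "left_translation S s = (\<lambda>t. Some (s \<otimes>\<^bsub>S\<^esub> t)) |` carrier S"

text \<open>Only meaningful for injective partial maps, where the preimage of a point is unique.\<close>

definition partial_inverse :: "('a \<rightharpoonup> 'a) \<Rightarrow> 'a \<rightharpoonup> 'a" where
  "partial_inverse g = (\<lambda>y. if y \<in> ran g then Some (THE x. g x = Some y) else None)"

definition partial_id :: "'a set \<Rightarrow> 'a \<rightharpoonup> 'a" where
  "partial_id X = Some |` X"

inductive_set left_inverse_hull :: "('a, 'b) monoid_scheme \<Rightarrow> ('a \<rightharpoonup> 'a) set" for S where
  translation: "s \<in> carrier S \<Longrightarrow> left_translation S s \<in> left_inverse_hull S"
| inverse: "g \<in> left_inverse_hull S \<Longrightarrow> partial_inverse g \<in> left_inverse_hull S"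
| comp: "\<lbrakk>g \<in> left_inverse_hull S; h \<in> left_inverse_hull S\<rbrakk> \<Longrightarrow> g \<circ>\<^sub>m h \<in> left_inverse_hull S"

definition constructible :: "('a, 'b) monoid_scheme \<Rightarrow> 'a set set" where
  "constructible S = dom ` left_inverse_hull S"

definition constructible_bar :: "('a, 'b) monoid_scheme \<Rightarrow> 'a set set" where
  "constructible_bar S = constructible S \<union>
     {X - \<Union>F | X F. X \<in> constructible S \<and> finite F \<and> F \<subseteq> constructible S}"


section \<open>Regularity\<close>

text \<open>
  The finite families \<open>h\<^sub>1, \<dots>, h\<^sub>n\<close>, \<open>X\<^sub>1, \<dots>, X\<^sub>m\<close> and \<open>Y\<^sub>1, \<dots>, Y\<^sub>l\<close> only matter
  through their ranges, so they are given as finite sets \<open>H\<close>, \<open>F\<close> and \<open>Ys\<close>.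
\<close>

definition fixed_points :: "('a \<rightharpoonup> 'a) \<Rightarrow> 'a set" where
  "fixed_points h = {s. h s = Some s}"

definition strongly_Cstar_regular :: "('a, 'b) monoid_scheme \<Rightarrow> bool" where
  "strongly_Cstar_regular S \<longleftrightarrow>
     (\<forall>H X F. finite H \<longrightarrow> H \<subseteq> left_inverse_hull S \<longrightarrow>
        X \<in> constructible S \<longrightarrow> finite F \<longrightarrow> F \<subseteq> constructible S \<longrightarrow>
        X - \<Union>F \<noteq> {} \<longrightarrow> X - \<Union>F \<subseteq> (\<Union>h\<in>H. fixed_points h) \<longrightarrow>
        (\<exists>Ys. finite Ys \<and> Ys \<subseteq> constructible S \<and> X - \<Union>F \<subseteq> \<Union>Ys \<and>
           (\<forall>Y\<in>Ys. \<exists>h\<in>H. h \<circ>\<^sub>m partial_id Y = partial_id Y)))"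

definition Cstar_regular :: "('a, 'b) monoid_scheme \<Rightarrow> bool" where
  "Cstar_regular S \<longleftrightarrow>
     (\<forall>H X. finite H \<longrightarrow> H \<subseteq> left_inverse_hull S \<longrightarrow> X \<in> constructible_bar S \<longrightarrow>
        X \<noteq> {} \<longrightarrow> X \<subseteq> (\<Union>h\<in>H. fixed_points h) \<longrightarrow>
        (\<exists>Ys. finite Ys \<and> Ys \<subseteq> constructible_bar S \<and> X \<subseteq> \<Union>Ys \<and>
           (\<forall>Y\<in>Ys. \<exists>h\<in>H. h \<circ>\<^sub>m partial_id Y = partial_id Y)))"


section \<open>Characters\<close>

text \<open>
  The semigroup \<open>{0, 1}\<close> is \<open>bool\<close> with conjunction. A character is a function on
  \<open>constructible S\<close> only, i.e. an extensional function, as required by \<open>product_topology\<close>.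
\<close>

definition characters :: "('a, 'b) monoid_scheme \<Rightarrow> ('a set \<Rightarrow> bool) set" where
  "characters S = {\<chi> \<in> constructible S \<rightarrow>\<^sub>E UNIV.
     (\<forall>X \<in> constructible S. \<forall>Y \<in> constructible S. \<chi> (X \<inter> Y) \<longleftrightarrow> \<chi> X \<and> \<chi> Y) \<and>
     (\<exists>X \<in> constructible S. \<chi> X)}"

definition character_topology :: "('a, 'b) monoid_scheme \<Rightarrow> ('a set \<Rightarrow> bool) topology" where
  "character_topology S =
     subtopology (product_topology (\<lambda>_. discrete_topology UNIV) (constructible S)) (characters S)"

definition point_character :: "('a, 'b) monoid_scheme \<Rightarrow> 'a \<Rightarrow> 'a set \<Rightarrow> bool" where
  "point_character S s = (\<lambda>X \<in> constructible S. s \<in> X)"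

definition Omega :: "('a, 'b) monoid_scheme \<Rightarrow> ('a set \<Rightarrow> bool) set" where
  "Omega S = character_topology S closure_of (point_character S ` carrier S)"

text \<open>
  The extension of a character to \<open>constructible_bar S\<close>. For \<open>\<chi> \<in> Omega S\<close> the value does not
  depend on how \<open>A\<close> is written as \<open>X - \<Union>F\<close>; \<open>F = {}\<close> covers \<open>A \<in> constructible S\<close>.
\<close>

definition char_ext :: "('a, 'b) monoid_scheme \<Rightarrow> ('a set \<Rightarrow> bool) \<Rightarrow> 'a set \<Rightarrow> bool" where
  "char_ext S \<chi> A \<longleftrightarrow>
     (\<exists>X F. X \<in> constructible S \<and> finite F \<and> F \<subseteq> constructible S \<and> A = X - \<Union>F \<and>
        \<chi> X \<and> (\<forall>Y\<in>F. \<not> \<chi> Y))"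


section \<open>The groupoids, as sets of equivalence classes\<close>

type_synonym 'a germ_pair = "('a \<rightharpoonup> 'a) \<times> ('a set \<Rightarrow> bool)"

definition germ_pairs :: "('a, 'b) monoid_scheme \<Rightarrow> 'a germ_pair set" where
  "germ_pairs S = {(g, \<chi>). g \<in> left_inverse_hull S \<and> \<chi> \<in> Omega S \<and> \<chi> (dom g)}"

definition GP_rel :: "('a, 'b) monoid_scheme \<Rightarrow> 'a germ_pair rel" where
  "GP_rel S = {((g\<^sub>1, \<chi>\<^sub>1), (g\<^sub>2, \<chi>\<^sub>2)).
     (g\<^sub>1, \<chi>\<^sub>1) \<in> germ_pairs S \<and> (g\<^sub>2, \<chi>\<^sub>2) \<in> germ_pairs S \<and> \<chi>\<^sub>1 = \<chi>\<^sub>2 \<and>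
     (\<exists>A \<in> constructible S. \<chi>\<^sub>1 A \<and> g\<^sub>1 |` A = g\<^sub>2 |` A)}"

definition GP :: "('a, 'b) monoid_scheme \<Rightarrow> 'a germ_pair set set" where
  "GP S = germ_pairs S // GP_rel S"

definition germ :: "('a, 'b) monoid_scheme \<Rightarrow> ('a \<rightharpoonup> 'a) \<Rightarrow> ('a set \<Rightarrow> bool) \<Rightarrow> 'a germ_pair set" where
  "germ S g \<chi> = GP_rel S `` {(g, \<chi>)}"

definition G_rel :: "('a, 'b) monoid_scheme \<Rightarrow> 'a germ_pair set rel" where
  "G_rel S = {(germ S g \<chi>, germ S h \<chi>) | g h \<chi>.
     (g, \<chi>) \<in> germ_pairs S \<and> (h, \<chi>) \<in> germ_pairs S \<and>
     (\<exists>X \<in> constructible_bar S. char_ext S \<chi> X \<and> g |` X = h |` X)}"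

definition G :: "('a, 'b) monoid_scheme \<Rightarrow> 'a germ_pair set set set" where
  "G S = GP S // G_rel S"

definition quotient_map_GP_G :: "('a, 'b) monoid_scheme \<Rightarrow> 'a germ_pair set \<Rightarrow> 'a germ_pair set set" where
  "quotient_map_GP_G S C = G_rel S `` {C}"

lemma quotient_map_GP_G_image: "quotient_map_GP_G S ` GP S = G S"
  by (auto simp: quotient_map_GP_G_def G_def quotient_def)

end

theory Submission
  imports Defs
begin

text \<open>
  Given \<open>X - \<Union>F \<subseteq> (\<Union>h\<in>H. fixed_points h)\<close>, C*-regularity covers \<open>X - \<Union>F\<close> by finitely many
  \<open>Y\<close> in \<open>constructible_bar S\<close>, each fixed by some \<open>h \<in> H\<close>. Every \<open>\<chi> \<in> Omega S\<close> living on
  \<open>X - \<Union>F\<close> is a limit of point characters and hence lives on one of these \<open>Y\<close>, so that \<open>[h, \<chi>]\<close>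
  and \<open>[1, \<chi>]\<close> agree in \<open>G S\<close>. By injectivity they agree in \<open>GP S\<close>: \<open>h\<close> fixes a constructible
  \<open>A\<close> with \<open>\<chi> A\<close>. Finitely many such \<open>A\<close> suffice by compactness of \<open>Omega S\<close>.
\<close>

section \<open>Partial injections, partial identities and differences of constructible sets\<close>

lemma inj_on_dom_iff:
  "inj_on g (dom g) \<longleftrightarrow> (\<forall>x y z. g x = Some z \<longrightarrow> g y = Some z \<longrightarrow> x = y)"
proof
  assume inj: "inj_on g (dom g)"
  show "\<forall>x y z. g x = Some z \<longrightarrow> g y = Some z \<longrightarrow> x = y"
    by (auto intro: inj_onD[OF inj])
qed (auto simp: inj_on_def)

lemma partial_inverse_eq_Some_iff:
  assumes "inj_on g (dom g)"
  shows "partial_inverse g y = Some x \<longleftrightarrow> g x = Some y"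
proof -
  have "(THE z. g z = Some y) = x" if "g x = Some y" for x
    using assms that unfolding inj_on_dom_iff by blast
  then show ?thesis
    by (auto simp: partial_inverse_def ran_def)
qed

lemma dom_partial_id [simp]: "dom (partial_id X) = X"
  by (auto simp: partial_id_def)

text \<open>Outside \<open>Y\<close> both sides are undefined, so the equation only constrains
  \<open>h\<close> on \<open>Y\<close>. This turns both regularity conditions into statements about
  covers by subsets of fixed-point sets.\<close>

lemma comp_partial_id_eq_iff:
  "h \<circ>\<^sub>m partial_id Y = partial_id Y \<longleftrightarrow> Y \<subseteq> fixed_points h"
  by (auto simp: partial_id_def map_comp_def restrict_map_def fun_eq_iff fixed_points_def)

lemma constructible_barE:
  assumes "Y \<in> constructible_bar S"
  obtains X F where "X \<in> constructible S" "finite F" "F \<subseteq> constructible S" "Y = X - \<Union>F"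
proof (cases "Y \<in> constructible S")
  case True
  then show ?thesis by (intro that[of Y "{}"]) auto
next
  case False
  then show ?thesis using assms that by (auto simp: constructible_bar_def)
qed

lemma constructible_barI:
  assumes "X \<in> constructible S" "finite F" "F \<subseteq> constructible S"
  shows "X - \<Union>F \<in> constructible_bar S"
  using assms by (auto simp: constructible_bar_def)

lemma char_ext_constructible: "\<lbrakk>A \<in> constructible S; \<chi> A\<rbrakk> \<Longrightarrow> char_ext S \<chi> A"
  unfolding char_ext_def by (intro exI[of _ A] exI[of _ "{}"]) auto

lemma char_ext_in_bar: "char_ext S \<chi> A \<Longrightarrow> A \<in> constructible_bar S"
  unfolding char_ext_def using constructible_barI by blast

text \<open>The pointwise core of transitivity for both germ relations: two agreements are combined
  on the common part of their sets.\<close>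

lemma restrict_map_eq_Int:
  assumes "f |` A = g |` A" "g |` B = h |` B"
  shows "f |` (A \<inter> B) = h |` (A \<inter> B)"
proof -
  have "f x = g x" if "x \<in> A" for x
    using fun_cong[OF assms(1), of x] that by simp
  moreover have "g x = h x" if "x \<in> B" for x
    using fun_cong[OF assms(2), of x] that by simp
  ultimately show ?thesis
    by (intro ext) (simp add: restrict_map_def)
qed


section \<open>The left inverse hull\<close>

context left_cancellative_monoid
begin

text \<open>Left cancellation makes translations injective, and injectivity survives inverses and
  composition. Only with it does \<open>partial_inverse\<close> denote a genuine inverse. The range
  is carried along because inversion swaps it with the domain.\<close>

lemma left_inverse_hull_inj_dom_ran:
  assumes "g \<in> left_inverse_hull S"
  shows "inj_on g (dom g) \<and> dom g \<subseteq> carrier S \<and> ran g \<subseteq> carrier S"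
  using assms
proof induction
  case (translation s)
  have app: "left_translation S s x = Some y \<longleftrightarrow> x \<in> carrier S \<and> y = s \<otimes> x" for x y
    by (auto simp: left_translation_def restrict_map_def)
  have "inj_on (left_translation S s) (dom (left_translation S s))"
    unfolding inj_on_dom_iff app using left_cancel[OF translation] by metis
  moreover have "dom (left_translation S s) = carrier S"
    by (auto simp: app)
  moreover have "ran (left_translation S s) \<subseteq> carrier S"
    using translation by (auto simp: ran_def app)
  ultimately show ?case by simp
next
  case (inverse g)
  then have inj: "inj_on g (dom g)" by simp
  note inv = partial_inverse_eq_Some_iff[OF inj]
  have "inj_on (partial_inverse g) (dom (partial_inverse g))"
    by (simp add: inj_on_dom_iff inv)
  moreover have "dom (partial_inverse g) = ran g"
    by (auto simp: partial_inverse_def split: if_splits)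
  moreover have "ran (partial_inverse g) = dom g"
    by (auto simp: inv ran_def)
  ultimately show ?case using inverse by simp
next
  case (comp g h)
  then have "inj_on (g \<circ>\<^sub>m h) (dom (g \<circ>\<^sub>m h))"
    unfolding inj_on_dom_iff map_comp_Some_iff by metis
  moreover have "dom (g \<circ>\<^sub>m h) \<subseteq> dom h" "ran (g \<circ>\<^sub>m h) \<subseteq> ran g"
    by (auto simp: ran_def map_comp_Some_iff)
  ultimately show ?case using comp by blast
qed

lemma constructible_subset_carrier: "X \<in> constructible S \<Longrightarrow> X \<subseteq> carrier S"
  using left_inverse_hull_inj_dom_ran by (auto simp: constructible_def)

lemma left_translation_one: "left_translation S \<one> = partial_id (carrier S)"
  by (auto simp: left_translation_def partial_id_def restrict_map_def)

lemma partial_id_carrier_in_hull: "partial_id (carrier S) \<in> left_inverse_hull S"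
  using left_inverse_hull.translation[OF one_closed] by (simp add: left_translation_one)

lemma carrier_constructible: "carrier S \<in> constructible S"
  using imageI[OF partial_id_carrier_in_hull, of dom] by (simp add: constructible_def)

text \<open>The identity on \<open>dom g\<close> is the idempotent obtained by following
  \<open>g\<close> with its inverse.\<close>

lemma partial_id_dom_in_hull:
  assumes "g \<in> left_inverse_hull S"
  shows "partial_id (dom g) \<in> left_inverse_hull S"
proof -
  have inj: "inj_on g (dom g)"
    using left_inverse_hull_inj_dom_ran assms by blast
  have "(partial_inverse g \<circ>\<^sub>m g) x = partial_id (dom g) x" for x
    using partial_inverse_eq_Some_iff[OF inj]
    by (cases "g x") (auto simp: partial_id_def restrict_map_def map_comp_def)
  then have "partial_inverse g \<circ>\<^sub>m g = partial_id (dom g)" by blast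
  then show ?thesis
    using left_inverse_hull.comp[OF left_inverse_hull.inverse[OF assms] assms] by simp
qed

text \<open>The intersection is the domain of the product of the two idempotents
  \<open>partial_id X\<close> and \<open>partial_id Y\<close>.\<close>

lemma constructible_Int:
  assumes "X \<in> constructible S" "Y \<in> constructible S"
  shows "X \<inter> Y \<in> constructible S"
proof -
  have "partial_id X \<circ>\<^sub>m partial_id Y \<in> left_inverse_hull S"
    using assms partial_id_dom_in_hull
    by (auto simp: constructible_def intro: left_inverse_hull.comp)
  then have "dom (partial_id X \<circ>\<^sub>m partial_id Y) \<in> constructible S"
    unfolding constructible_def by (rule imageI)
  moreover have "dom (partial_id X \<circ>\<^sub>m partial_id Y) = X \<inter> Y"
    by (auto simp: partial_id_def map_comp_def restrict_map_def split: if_splits)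
  ultimately show ?thesis by simp
qed


section \<open>The space of characters\<close>

abbreviation "prodtop \<equiv> product_topology (\<lambda>_. discrete_topology (UNIV :: bool set)) (constructible S)"

text \<open>Evaluation at \<open>X\<close> is a continuous coordinate projection to a discrete
  space, where every \<open>B\<close> is clopen.\<close>

lemma closedin_eval:
  assumes "X \<in> constructible S"
  shows "closedin prodtop {\<chi> \<in> topspace prodtop. \<chi> X \<in> B}"
  by (rule closedin_continuous_map_preimage[OF continuous_map_product_projection[OF assms]]) simp

lemma openin_eval:
  assumes "X \<in> constructible S"
  shows "openin prodtop {\<chi> \<in> topspace prodtop. \<chi> X \<in> B}"
  by (rule openin_continuous_map_preimage[OF continuous_map_product_projection[OF assms]]) simp

text \<open>Neighbourhoods in the product topology may prescribe finitely many coordinates, so on a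
  finite \<open>C\<close> a limit of point characters coincides with one of them. Facts about points
  thereby transfer to characters.\<close>

lemma closure_point_character_approx:
  assumes \<chi>: "\<chi> \<in> prodtop closure_of (point_character S ` carrier S)"
    and C: "finite C" "C \<subseteq> constructible S"
  shows "\<exists>s\<in>carrier S. \<forall>X\<in>C. \<chi> X \<longleftrightarrow> s \<in> X"
proof -
  have top: "\<chi> \<in> topspace prodtop" using \<chi> by (simp add: in_closure_of)
  \<comment> \<open>The factor \<open>topspace prodtop\<close> keeps \<open>U\<close> open when
    \<open>C\<close> is empty, since an empty intersection is \<open>UNIV\<close>.\<close>
  define U where "U = (\<Inter>X\<in>C. {\<psi> \<in> topspace prodtop. \<psi> X \<in> {\<chi> X}}) \<inter> topspace prodtop"
  have "openin prodtop U"
    unfolding U_def using C by (intro openin_INT openin_eval) auto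
  moreover have "\<chi> \<in> U" using top by (simp add: U_def)
  ultimately obtain s where "s \<in> carrier S" "point_character S s \<in> U"
    using \<chi> unfolding in_closure_of by blast
  then show ?thesis using C by (auto simp: U_def point_character_def subset_iff)
qed

text \<open>Multiplicativity and the value at \<open>carrier S\<close> involve finitely many
  coordinates at a time, so they pass from point characters to their limits. The closure in the full
  product thus stays inside \<open>characters S\<close>, which makes compactness of the product
  available.\<close>

lemma Omega_eq_closure: "Omega S = prodtop closure_of (point_character S ` carrier S)"
proof -
  have "point_character S ` carrier S \<subseteq> characters S"
    using carrier_constructible constructible_Int
    by (auto simp: point_character_def characters_def)
  moreover have "prodtop closure_of (point_character S ` carrier S) \<subseteq> characters S"
  proof
    fix \<chi> assume \<chi>: "\<chi> \<in> prodtop closure_of (point_character S ` carrier S)"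
    have "\<chi> (X \<inter> Y) \<longleftrightarrow> \<chi> X \<and> \<chi> Y" if "X \<in> constructible S" "Y \<in> constructible S" for X Y
      using closure_point_character_approx[OF \<chi>, of "{X, Y, X \<inter> Y}"] that constructible_Int
      by auto
    moreover have "\<chi> (carrier S)"
      using closure_point_character_approx[OF \<chi>, of "{carrier S}"] carrier_constructible by auto
    moreover have "\<chi> \<in> topspace prodtop" using \<chi> by (simp add: in_closure_of)
    ultimately show "\<chi> \<in> characters S"
      using carrier_constructible by (auto simp: characters_def)
  qed
  ultimately show ?thesis
    by (simp add: Omega_def character_topology_def closure_of_subtopology Int_absorb1)
qed

lemma Omega_approx:
  assumes "\<chi> \<in> Omega S" "finite C" "C \<subseteq> constructible S"
  shows "\<exists>s\<in>carrier S. \<forall>X\<in>C. \<chi> X \<longleftrightarrow> s \<in> X"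
  using closure_point_character_approx assms unfolding Omega_eq_closure by simp

lemma point_character_in_Omega: "s \<in> carrier S \<Longrightarrow> point_character S s \<in> Omega S"
  unfolding Omega_eq_closure
  by (rule subsetD[OF closure_of_subset]) (auto simp: point_character_def)

lemma Omega_carrier: "\<chi> \<in> Omega S \<Longrightarrow> \<chi> (carrier S)"
  using Omega_approx[of \<chi> "{carrier S}"] carrier_constructible by auto

lemma Omega_Int:
  assumes "\<chi> \<in> Omega S" "X \<in> constructible S" "Y \<in> constructible S"
  shows "\<chi> (X \<inter> Y) \<longleftrightarrow> \<chi> X \<and> \<chi> Y"
  using Omega_approx[of \<chi> "{X, Y, X \<inter> Y}"] assms constructible_Int by auto

text \<open>The characters in \<open>Omega S\<close> living on \<open>X - \<Union>F\<close> form a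
  closed subset of a compact product of two-point spaces, and each condition \<open>\<chi> A\<close>
  is open. A finite subcover, read at point characters, covers the points themselves.\<close>

lemma Omega_finite_subcover:
  assumes \<A>: "\<A> \<subseteq> constructible S"
    and X: "X \<in> constructible S" and F: "F \<subseteq> constructible S"
    and cover: "\<And>\<chi>. \<lbrakk>\<chi> \<in> Omega S; \<chi> X; \<forall>Y\<in>F. \<not> \<chi> Y\<rbrakk> \<Longrightarrow> \<exists>A\<in>\<A>. \<chi> A"
  obtains \<B> where "finite \<B>" "\<B> \<subseteq> \<A>" "X - \<Union>F \<subseteq> \<Union>\<B>"
proof -
  define D where "D A = {\<chi> \<in> topspace prodtop. \<chi> A \<in> {True}}" for A
  define N where "N A = {\<chi> \<in> topspace prodtop. \<chi> A \<in> {False}}" for A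
  define K where "K = \<Inter>(insert (Omega S) (insert (D X) (N ` F)))"
  have "closedin prodtop K"
    unfolding K_def
  proof (rule closedin_Inter)
    fix T assume "T \<in> insert (Omega S) (insert (D X) (N ` F))"
    then consider "T = Omega S" | "T = D X" | Y where "Y \<in> F" "T = N Y"
      by blast
    then show "closedin prodtop T"
    proof cases
      case 1
      then show ?thesis by (simp only: Omega_eq_closure closedin_closure_of)
    next
      case 2
      then show ?thesis unfolding D_def by (simp only: closedin_eval[OF X])
    next
      case 3
      then show ?thesis unfolding N_def by (simp only: closedin_eval[OF subsetD[OF F]])
    qed
  qed simp
  then have "compactin prodtop K"
    by (intro closedin_compact_space)
       (auto simp: compact_space_product_topology compact_space_discrete_topology)
  moreover have "openin prodtop (D A)" if "A \<in> \<A>" for A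
    unfolding D_def using that \<A> by (intro openin_eval) blast
  moreover have "K \<subseteq> \<Union>(D ` \<A>)"
  proof
    fix \<chi> assume "\<chi> \<in> K"
    then have "\<chi> \<in> topspace prodtop" "\<chi> \<in> Omega S" "\<chi> X" "\<forall>Y\<in>F. \<not> \<chi> Y"
      by (auto simp: K_def D_def N_def)
    then show "\<chi> \<in> \<Union>(D ` \<A>)" using cover by (auto simp: D_def)
  qed
  ultimately obtain \<F> where \<F>: "finite \<F>" "\<F> \<subseteq> D ` \<A>" "K \<subseteq> \<Union>\<F>"
    using compactinD[of prodtop K "D ` \<A>"] by blast
  obtain \<B> where \<B>: "finite \<B>" "\<B> \<subseteq> \<A>" "K \<subseteq> \<Union>(D ` \<B>)"
    using finite_subset_image[OF \<F>(1,2)] \<F>(3) by blast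
  have "X - \<Union>F \<subseteq> \<Union>\<B>"
  proof
    fix s assume s: "s \<in> X - \<Union>F"
    then have "s \<in> carrier S" using X constructible_subset_carrier by blast
    \<comment> \<open>A point character evaluates to membership of its point, so a point of
      \<open>X - \<Union>F\<close> satisfies all the conditions defining \<open>K\<close>.\<close>
    then have "point_character S s \<in> K"
      using s X F point_character_in_Omega
      by (auto simp: K_def D_def N_def point_character_def subset_iff)
    then obtain A where "A \<in> \<B>" "point_character S s A"
      using \<B>(3) by (auto simp: D_def)
    then show "s \<in> \<Union>\<B>" using \<B>(2) \<A> by (auto simp: point_character_def subset_iff)
  qed
  then show ?thesis using \<B> that by blast
qed

section \<open>Characters extended to \<open>constructible_bar S\<close>\<close>

text \<open>A point imitating \<open>\<chi>\<close> on every constructible set involved lies in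
  \<open>X - \<Union>F\<close>, hence in some \<open>Y\<close>. Its membership pattern then shows
  that \<open>\<chi>\<close> lives on this \<open>Y\<close>.\<close>

lemma char_ext_cases:
  assumes \<chi>: "\<chi> \<in> Omega S" and X: "X \<in> constructible S" "\<chi> X"
    and F: "finite F" "F \<subseteq> constructible S" "\<forall>Y\<in>F. \<not> \<chi> Y"
    and Ys: "finite Ys" "Ys \<subseteq> constructible_bar S" "X - \<Union>F \<subseteq> \<Union>Ys"
  obtains Y where "Y \<in> Ys" "char_ext S \<chi> Y"
proof -
  have "\<exists>Z E. Z \<in> constructible S \<and> finite E \<and> E \<subseteq> constructible S \<and> Y = Z - \<Union>E"
    if "Y \<in> Ys" for Y
    using that Ys(2) constructible_barE[of Y S] by (metis subsetD)
  then obtain Z E where ZE: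
    "\<And>Y. Y \<in> Ys \<Longrightarrow> Z Y \<in> constructible S \<and> finite (E Y) \<and> E Y \<subseteq> constructible S \<and> Y = Z Y - \<Union>(E Y)"
    by metis
  \<comment> \<open>All sets on which \<open>\<chi>\<close> must be compared with a point: those
    describing \<open>X - \<Union>F\<close> and those in the chosen presentation of each
    \<open>Y\<close>.\<close>
  define C where "C = insert X (F \<union> Z ` Ys \<union> \<Union>(E ` Ys))"
  have "finite C" using ZE Ys F by (auto simp: C_def)
  moreover have "C \<subseteq> constructible S" unfolding C_def using ZE X F by blast
  ultimately obtain s where s: "\<forall>A\<in>C. \<chi> A \<longleftrightarrow> s \<in> A"
    using Omega_approx[OF \<chi>] by blast
  have "s \<in> X - \<Union>F" using s X F by (auto simp: C_def)
  then obtain Y where Y: "Y \<in> Ys" "s \<in> Y" using Ys by blast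
  then have "s \<in> Z Y" "\<forall>A\<in>E Y. s \<notin> A" using ZE[OF Y(1)] by blast+
  then have "\<chi> (Z Y)" "\<forall>A\<in>E Y. \<not> \<chi> A"
    using s Y(1) by (auto simp: C_def)
  then have "char_ext S \<chi> Y" unfolding char_ext_def using ZE[OF Y(1)] by blast
  then show ?thesis using Y that by blast
qed

text \<open>A point imitating \<open>\<chi>\<close> lies in \<open>Y\<close>, hence in
  \<open>X\<close>. This later yields \<open>\<chi> (dom h)\<close>, so that \<open>h\<close> has a
  germ at \<open>\<chi>\<close>.\<close>

lemma char_ext_mono:
  assumes "\<chi> \<in> Omega S" "char_ext S \<chi> Y" "Y \<subseteq> X" "X \<in> constructible S"
  shows "\<chi> X"
proof -
  obtain Z E where ZE: "Z \<in> constructible S" "finite E" "E \<subseteq> constructible S" "Y = Z - \<Union>E"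
    "\<chi> Z" "\<forall>A\<in>E. \<not> \<chi> A"
    using assms(2) unfolding char_ext_def by blast
  obtain s where "\<forall>A\<in>insert X (insert Z E). \<chi> A \<longleftrightarrow> s \<in> A"
    using Omega_approx[OF assms(1), of "insert X (insert Z E)"] ZE assms(4) by auto
  then show ?thesis using ZE assms(3) by auto
qed

lemma char_ext_Int:
  assumes "\<chi> \<in> Omega S" "char_ext S \<chi> A" "char_ext S \<chi> B"
  shows "char_ext S \<chi> (A \<inter> B)"
proof -
  obtain X F where X: "X \<in> constructible S" "finite F" "F \<subseteq> constructible S" "A = X - \<Union>F"
    "\<chi> X" "\<forall>Y\<in>F. \<not> \<chi> Y"
    using assms(2) unfolding char_ext_def by blast
  obtain Z E where Z: "Z \<in> constructible S" "finite E" "E \<subseteq> constructible S" "B = Z - \<Union>E"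
    "\<chi> Z" "\<forall>Y\<in>E. \<not> \<chi> Y"
    using assms(3) unfolding char_ext_def by blast
  have "A \<inter> B = X \<inter> Z - \<Union>(F \<union> E)" using X Z by blast
  then show ?thesis
    unfolding char_ext_def using X Z constructible_Int Omega_Int[OF assms(1)]
    by (intro exI[of _ "X \<inter> Z"] exI[of _ "F \<union> E"]) auto
qed


section \<open>Germs\<close>

text \<open>Reflexivity uses \<open>dom g\<close> as the set of agreement. Transitivity intersects
  two such sets, and multiplicativity of \<open>\<chi>\<close> keeps the value true there.\<close>

lemma equiv_GP_rel: "equiv (germ_pairs S) (GP_rel S)"
proof (rule equivI)
  show "refl_on (germ_pairs S) (GP_rel S)"
  proof (rule refl_onI)
    fix p assume p: "p \<in> germ_pairs S"
    obtain g \<chi> where g: "p = (g, \<chi>)" by (rule prod.exhaust)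
    have "dom g \<in> constructible S" "\<chi> (dom g)"
      using p by (simp_all add: g germ_pairs_def constructible_def)
    then show "(p, p) \<in> GP_rel S" using p unfolding g GP_rel_def by blast
  qed
  show "GP_rel S \<subseteq> germ_pairs S \<times> germ_pairs S"
    unfolding GP_rel_def by blast
  show "sym (GP_rel S)"
  proof (rule symI)
    fix p q assume "(p, q) \<in> GP_rel S"
    then obtain g \<chi> h A where *: "p = (g, \<chi>)" "q = (h, \<chi>)" "p \<in> germ_pairs S"
      "q \<in> germ_pairs S" "A \<in> constructible S" "\<chi> A" "g |` A = h |` A"
      unfolding GP_rel_def by blast
    then show "(q, p) \<in> GP_rel S"
      using *(7)[symmetric] unfolding GP_rel_def by blast
  qed
  show "trans (GP_rel S)"
  proof (rule transI)
    fix p q r assume pq: "(p, q) \<in> GP_rel S" and qr: "(q, r) \<in> GP_rel S"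
    obtain f \<chi> g A where p: "p = (f, \<chi>)" "q = (g, \<chi>)" "p \<in> germ_pairs S"
      "A \<in> constructible S" "\<chi> A" "f |` A = g |` A"
      using pq unfolding GP_rel_def by blast
    obtain h B where r: "r = (h, \<chi>)" "r \<in> germ_pairs S"
      "B \<in> constructible S" "\<chi> B" "g |` B = h |` B"
      using qr p(2) unfolding GP_rel_def by blast
    have "\<chi> (A \<inter> B)" using Omega_Int[of \<chi> A B] p r by (simp add: germ_pairs_def)
    moreover have "A \<inter> B \<in> constructible S" using p r constructible_Int by blast
    moreover have "f |` (A \<inter> B) = h |` (A \<inter> B)" using p r restrict_map_eq_Int by blast
    ultimately show "(p, r) \<in> GP_rel S"
      using p r unfolding GP_rel_def by blast
  qed
qed

lemma germ_eq_iff: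
  assumes "(g, \<chi>) \<in> germ_pairs S" "(h, \<psi>) \<in> germ_pairs S"
  shows "germ S g \<chi> = germ S h \<psi> \<longleftrightarrow> ((g, \<chi>), (h, \<psi>)) \<in> GP_rel S"
  using equiv_GP_rel assms unfolding germ_def by (simp add: eq_equiv_class_iff)

section \<open>The coarser relation on germs\<close>

lemma sym_G_rel: "sym (G_rel S)"
proof (rule symI)
  fix p q assume "(p, q) \<in> G_rel S"
  then obtain g h \<chi> X where *: "p = germ S g \<chi>" "q = germ S h \<chi>"
    "(g, \<chi>) \<in> germ_pairs S" "(h, \<chi>) \<in> germ_pairs S"
    "X \<in> constructible_bar S" "char_ext S \<chi> X" "g |` X = h |` X"
    unfolding G_rel_def by blast
  then show "(q, p) \<in> G_rel S"
    using *(7)[symmetric] unfolding G_rel_def by blast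
qed

lemma trans_G_rel: "trans (G_rel S)"
proof (rule transI)
  fix p q r assume pq: "(p, q) \<in> G_rel S" and qr: "(q, r) \<in> G_rel S"
  obtain f g \<chi> X where 1: "p = germ S f \<chi>" "q = germ S g \<chi>" "(f, \<chi>) \<in> germ_pairs S"
    "(g, \<chi>) \<in> germ_pairs S" "char_ext S \<chi> X" "f |` X = g |` X"
    using pq unfolding G_rel_def by blast
  obtain g' h \<psi> Y where 2: "q = germ S g' \<psi>" "r = germ S h \<psi>" "(g', \<psi>) \<in> germ_pairs S"
    "(h, \<psi>) \<in> germ_pairs S" "char_ext S \<psi> Y" "g' |` Y = h |` Y"
    using qr unfolding G_rel_def by blast
  \<comment> \<open>The middle germ may come with different representatives \<open>g\<close> and
    \<open>g'\<close> in the two hypotheses. They agree on a constructible \<open>A\<close>, so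
    \<open>f\<close> and \<open>h\<close> are compared on
    \<open>X \<inter> A \<inter> Y\<close>.\<close>
  have "((g, \<chi>), (g', \<psi>)) \<in> GP_rel S"
    using germ_eq_iff[OF 1(4) 2(3)] 1(2) 2(1) by simp
  then obtain A where A: "\<psi> = \<chi>" "A \<in> constructible S" "\<chi> A" "g |` A = g' |` A"
    unfolding GP_rel_def by blast
  have \<chi>: "\<chi> \<in> Omega S" using 1(3) by (simp add: germ_pairs_def)
  have "f |` (X \<inter> A \<inter> Y) = h |` (X \<inter> A \<inter> Y)"
    by (rule restrict_map_eq_Int[OF restrict_map_eq_Int[OF 1(6) A(4)] 2(6)])
  moreover have "char_ext S \<chi> (X \<inter> A \<inter> Y)"
    using char_ext_Int[OF \<chi>] 1(5) 2(5) char_ext_constructible A by blast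
  ultimately show "(p, r) \<in> G_rel S"
    using 1 2 A char_ext_in_bar unfolding G_rel_def by blast
qed

lemma quotient_map_GP_G_eqI:
  assumes "(C, D) \<in> G_rel S"
  shows "quotient_map_GP_G S C = quotient_map_GP_G S D"
proof -
  have "(D, C) \<in> G_rel S" using symD[OF sym_G_rel assms] .
  then show ?thesis
    using assms unfolding quotient_map_GP_G_def by (blast intro: transD[OF trans_G_rel])
qed

text \<open>On \<open>Y\<close> the map \<open>h\<close> agrees with the identity, so their germs at
  \<open>\<chi>\<close> have the same image in \<open>G S\<close>. Injectivity makes the germs
  equal, and equality in \<open>GP S\<close> provides agreement on a constructible set.\<close>

lemma GP_G_injective_fixed:
  assumes inj: "inj_on (quotient_map_GP_G S) (GP S)"
    and \<chi>: "\<chi> \<in> Omega S" and h: "h \<in> left_inverse_hull S"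
    and Y: "char_ext S \<chi> Y" "Y \<subseteq> fixed_points h"
  shows "\<exists>A\<in>constructible S. \<chi> A \<and> A \<subseteq> fixed_points h"
proof -
  let ?e = "partial_id (carrier S)"
  have dom_h: "dom h \<in> constructible S" using h by (auto simp: constructible_def)
  have Yd: "Y \<subseteq> dom h" using Y by (auto simp: fixed_points_def)
  have "\<chi> (dom h)" using char_ext_mono[OF \<chi> Y(1) Yd dom_h] .
  then have h\<chi>: "(h, \<chi>) \<in> germ_pairs S" using h \<chi> by (simp add: germ_pairs_def)
  have e\<chi>: "(?e, \<chi>) \<in> germ_pairs S"
    using partial_id_carrier_in_hull \<chi> Omega_carrier by (simp add: germ_pairs_def)
  have "Y \<subseteq> carrier S" using Yd dom_h constructible_subset_carrier by blast
  then have "h |` Y = ?e |` Y"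
    using Y(2) by (auto simp: fun_eq_iff restrict_map_def partial_id_def fixed_points_def)
  then have "(germ S h \<chi>, germ S ?e \<chi>) \<in> G_rel S"
    using h\<chi> e\<chi> Y(1) char_ext_in_bar unfolding G_rel_def by blast
  then have "quotient_map_GP_G S (germ S h \<chi>) = quotient_map_GP_G S (germ S ?e \<chi>)"
    by (rule quotient_map_GP_G_eqI)
  moreover have "germ S h \<chi> \<in> GP S" "germ S ?e \<chi> \<in> GP S"
    using h\<chi> e\<chi> by (auto simp: GP_def germ_def intro: quotientI)
  ultimately have "germ S h \<chi> = germ S ?e \<chi>" using inj by (auto dest: inj_onD)
  then obtain A where A: "A \<in> constructible S" "\<chi> A" "h |` A = ?e |` A"
    using germ_eq_iff[OF h\<chi> e\<chi>] by (auto simp: GP_rel_def)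
  \<comment> \<open>Agreement with \<open>?e\<close> means being fixed because \<open>A\<close> lies
    in \<open>carrier S\<close>, the domain of \<open>?e\<close>.\<close>
  have "h a = Some a" if "a \<in> A" for a
    using fun_cong[OF A(3), of a] that constructible_subset_carrier[OF A(1)]
    by (auto simp: partial_id_def)
  then show ?thesis using A by (auto simp: fixed_points_def)
qed

lemma Cstar_regular_imp_strongly:
  assumes reg: "Cstar_regular S"
    and inj: "inj_on (quotient_map_GP_G S) (GP S)"
  shows "strongly_Cstar_regular S"
  unfolding strongly_Cstar_regular_def comp_partial_id_eq_iff
proof (intro allI impI)
  fix H X F
  assume H: "finite H" "H \<subseteq> left_inverse_hull S"
    and X: "X \<in> constructible S" and F: "finite F" "F \<subseteq> constructible S"
    and ne: "X - \<Union>F \<noteq> {}" and sub: "X - \<Union>F \<subseteq> (\<Union>h\<in>H. fixed_points h)"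
  obtain Ys where Ys: "finite Ys" "Ys \<subseteq> constructible_bar S" "X - \<Union>F \<subseteq> \<Union>Ys"
    "\<forall>Y\<in>Ys. \<exists>h\<in>H. Y \<subseteq> fixed_points h"
    using reg[unfolded Cstar_regular_def comp_partial_id_eq_iff, rule_format,
        OF H constructible_barI[OF X F] ne sub] by blast
  \<comment> \<open>All admissible members of a cover, chosen independently of \<open>\<chi>\<close>
    and possibly infinite in number. Compactness will extract the finite family.\<close>
  define \<A> where "\<A> = {A \<in> constructible S. \<exists>h\<in>H. A \<subseteq> fixed_points h}"
  have "\<exists>A\<in>\<A>. \<chi> A" if \<chi>: "\<chi> \<in> Omega S" "\<chi> X" "\<forall>Y\<in>F. \<not> \<chi> Y" for \<chi>
  proof -
    obtain Y where Y: "Y \<in> Ys" "char_ext S \<chi> Y"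
      using char_ext_cases[OF \<chi>(1) X \<chi>(2) F \<chi>(3) Ys(1-3)] by blast
    then obtain h where "h \<in> H" "Y \<subseteq> fixed_points h" using Ys(4) by blast
    then show ?thesis
      using GP_G_injective_fixed[OF inj \<chi>(1) _ Y(2)] H(2) unfolding \<A>_def by blast
  qed
  moreover have "\<A> \<subseteq> constructible S" by (auto simp: \<A>_def)
  ultimately obtain \<B> where "finite \<B>" "\<B> \<subseteq> \<A>" "X - \<Union>F \<subseteq> \<Union>\<B>"
    using Omega_finite_subcover[OF _ X F(2)] by metis
  then show "\<exists>Ys. finite Ys \<and> Ys \<subseteq> constructible S \<and> X - \<Union>F \<subseteq> \<Union>Ys \<and>
      (\<forall>Y\<in>Ys. \<exists>h\<in>H. Y \<subseteq> fixed_points h)"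
    by (intro exI[of _ \<B>]) (auto simp: \<A>_def)
qed

end

theorem proposition4p1:
  fixes S :: "('a, 'b) monoid_scheme"
  assumes "left_cancellative_monoid S"
    and "Cstar_regular S"
    and "inj_on (quotient_map_GP_G S) (GP S)"
  shows "strongly_Cstar_regular S"
  using assms left_cancellative_monoid.Cstar_regular_imp_strongly by blast

end
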